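(* Let $p\ge 11$ be a prime, let $\chi$ be the quadratic character of $\mathbb F_p$, and let $$\mathcal A_p=\{a\in\mathbb F_p^*:\chi(a)=\chi(1-4a)=\chi(1-4/a)=-1\},\qquad T_p=\sum_{z\in\mathbb F_p}\chi\bigl(z(z-4)(1-4z)\bigr).$$ Then $$|\mathcal A_p|=\frac{p+1+T_p}{8},\qquad |T_p|\le 2\sqrt p.$$ In particular, $|\mathcal A_p|\ge (p+1-2\sqrt p)/8>0$.
   Context: The quadratic character $\chi$ of $\mathbb F_p$ satisfies $\chi(0)=0$, $\chi(x)=1$ if $x$ is a nonzero square, and $\chi(x)=-1$ if $x$ is a nonsquare. *)

theory Defs
  imports Complex_Main "Berlekamp_Zassenhaus.Finite_Field"
begin

definition quadratic_character :: "'a::field \<Rightarrow> int" where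
  "quadratic_character x =
     (if x = 0 then 0 else if \<exists>y. x = y ^ 2 then 1 else - 1)"

text \<open>
  The field of order \<open>p\<close> is the type \<open>'p mod_ring\<close> of integers modulo \<open>p = CARD('p)\<close>; the class
  constraint on \<open>'p\<close> says that this cardinality is prime. Division is that of the field.
\<close>

definition A_set :: "'p::prime_card itself \<Rightarrow> 'p mod_ring set" where
  "A_set _ = {a. a \<noteq> 0 \<and> quadratic_character a = - 1 \<and> quadratic_character (1 - 4 * a) = - 1
                \<and> quadratic_character (1 - 4 / a) = - 1}"

definition T_sum :: "'p::prime_card itself \<Rightarrow> int" where
  "T_sum _ = (\<Sum>z\<in>(UNIV :: 'p mod_ring set).
                quadratic_character (z * (z - 4) * (1 - 4 * z)))"

end

theory Submission
  imports Defs "HOL-Computational_Algebra.Polynomial_Factorial"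
begin

text \<open>
  Counting. The product \<open>(1 - \<chi>(a)) (1 - \<chi>(1 - 4a)) (1 - \<chi>(a(a - 4)))\<close> is \<open>8\<close> on the set in question and
  \<open>0\<close> elsewhere: for \<open>a \<noteq> 0\<close> the last argument is \<open>1 - 4/a\<close> times a square, and the points
  \<open>1/4\<close> and \<open>4\<close>, where a character vanishes, are squares. Expanding it and summing over \<open>a\<close> leaves sums of \<open>\<chi>\<close> over linear and
  quadratic polynomials, which are elementary and add up to \<open>p + 1\<close>, and the cubic sum \<open>T\<close>
  (\<open>card_eq_character_sum\<close>).

  Bounding \<open>T\<close>. Up to the substitution \<open>u = -4z\<close>, \<open>T\<close> is the sum of \<open>\<chi>(f(u))\<close> for the separable cubic
  \<open>f(u) = u (u + 1) (u + 16)\<close>, and \<open>T\<^sup>2 \<le> 4p\<close> is Hasse's theorem for \<open>y\<^sup>2 = f(x)\<close>. The proof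
  (\<open>hasse_bound\<close>) is a version of Manin's that uses only x-coordinates. Over the field of rational
  functions in \<open>t\<close>, the twisted curve \<open>f(t) y\<^sup>2 = f(x)\<close> has the points \<open>Q = (t, 1)\<close> and, for
  \<open>q\<close> the size of the finite field, the Frobenius point \<open>P\<^sub>0 = (t^q, f(t)^((q-1)/2))\<close>. Write the
  x-coordinate of \<open>P\<^sub>n = P\<^sub>0 + n Q\<close> as a reduced fraction \<open>X/Z\<close> and let \<open>d(n)\<close> be the degree of \<open>X\<close>. Then
  \<open>d(n-1) + d(n+1) = 2 d(n) + 2\<close>, while \<open>d(0) = q\<close> and \<open>d(-1) = q + 1 + T\<close>. Hence
  \<open>d(n) = n\<^sup>2 - T n + q\<close>, and since a degree is never negative, the discriminant \<open>T\<^sup>2 - 4q\<close> of this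
  quadratic polynomial cannot be positive.

  The group law itself is avoided. The x-coordinates of \<open>P + Q\<close> and \<open>P - Q\<close> are the roots of a
  quadratic polynomial whose coefficients are forms in the x-coordinate of \<open>P\<close>. The relation ``being
  such a root'' is symmetric (\<open>adjacent_sym\<close>), so that from two consecutive terms of the sequence the
  next one is found as the other root of a quadratic polynomial one of whose roots is already known
  (\<open>next_abscissa\<close>). That the resulting fractions are automatically reduced, which is what makes the
  degree recurrence exact, comes from the separability of \<open>f\<close> (\<open>prime_not_dvd_forms\<close>). The value of
  \<open>d(-1)\<close> is where the point count enters: it measures how much of \<open>t^q - t = \<Prod> (t - r)\<close> cancels, and
  that depends at each \<open>r\<close> on whether \<open>f(r)\<close> is a nonzero square, zero, or a nonsquare.
\<close>

section \<open>The x-coordinates of an arithmetic progression of points\<close>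

text \<open>
  If the fraction \<open>A/B\<close> in lowest terms is a root of \<open>G\<^sub>0 x\<^sup>2 - G\<^sub>1 x + G\<^sub>2\<close>, then by Gauss' lemma the
  quadratic polynomial splits over the ring itself as \<open>(B x - A) (D x - C)\<close>. The other root is \<open>C/D\<close>,
  and the conclusion consists of Vieta's formulas without denominators. The homogeneous form covers
  \<open>B = 0\<close> as well, the point at infinity.
\<close>

lemma vieta_coprime_root:
  fixes A B G0 G1 G2 :: "'r::{ring_gcd,idom}"
  assumes cop: "coprime A B" and A: "A \<noteq> 0"
    and root: "G0 * A^2 - G1 * A * B + G2 * B^2 = 0"
  obtains C D where "G0 = B * D" "G1 = A * D + B * C" "G2 = A * C"
proof -
  have "G2 * B^2 = A * (G1 * B - G0 * A)"
    using root by (simp add: algebra_simps power2_eq_square)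
  hence "A dvd G2 * B^2" by simp
  hence "A dvd G2"
    using cop by (simp add: coprime_dvd_mult_left_iff)
  then obtain C where C: "G2 = A * C" ..
  have "A * (G0 * A - B * (G1 - B * C)) = 0"
    using root unfolding C by (simp add: algebra_simps power2_eq_square)
  hence eq: "G0 * A = B * (G1 - B * C)"
    using A by simp
  hence "A dvd B * (G1 - B * C)" by (metis dvd_triv_right)
  hence "A dvd G1 - B * C"
    using cop by (simp add: coprime_dvd_mult_right_iff)
  then obtain D where D: "G1 - B * C = A * D" ..
  have "A * (G0 - B * D) = 0"
    using eq unfolding D by (simp add: algebra_simps)
  hence "G0 = B * D" using A by simp
  moreover have "G1 = A * D + B * C" using D by (simp add: algebra_simps)
  ultimately show thesis using C that by blast
qed

text \<open>
  The three identities below concern the forms \<open>G0\<close>, \<open>G1\<close>, \<open>G2\<close> introduced afterwards. They are stated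
  over an abstract integral domain, so that the simplifier does not take apart the
  polynomials \<open>[:0, 1:]\<close>, \<open>[:a:]\<close>, \<open>[:b:]\<close>, \<open>[:c:]\<close> that take the place of the variables.
\<close>

lemma ring_identity_adjacent_sym:
  fixes X Z A B t a b c :: "'r::idom"
  shows "(X - t * Z)^2 * A^2
    - 2 * ((X * t + b * Z) * (X + t * Z) + 2 * a * t * X * Z + 2 * c * Z^2) * A * B
    + ((X * t - b * Z)^2 - 4 * c * Z * (X + t * Z + a * Z)) * B^2 =
    (A - t * B)^2 * X^2
    - 2 * ((A * t + b * B) * (A + t * B) + 2 * a * t * A * B + 2 * c * B^2) * X * Z
    + ((A * t - b * B)^2 - 4 * c * B * (A + t * B + a * B)) * Z^2"
  by (simp add: power2_eq_square power3_eq_cube algebra_simps)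

lemma ring_identity_G1_at_tZ:
  fixes X Z t a b c :: "'r::idom"
  shows "2 * ((X * t + b * Z) * (X + t * Z) + 2 * a * t * X * Z + 2 * c * Z^2)
     - 4 * (t^3 + a * t^2 + b * t + c) * Z^2 =
    (X - t * Z) * (2 * (t * (X + 2 * t * Z) + b * Z + 2 * a * t * Z))"
  by (simp add: power2_eq_square power3_eq_cube algebra_simps)

lemma ring_identity_G2_at_tZ:
  fixes X Z t a b c :: "'r::idom"
  shows "(X * t - b * Z)^2 - 4 * c * Z * (X + t * Z + a * Z)
    - ((3 * t^2 + 2 * a * t + b)^2 - 4 * (2 * t + a) * (t^3 + a * t^2 + b * t + c)) * Z^2 =
    (X - t * Z) * (t * (t * (X + t * Z) - 2 * b * Z) - 4 * c * Z)"
  by (simp add: power2_eq_square power3_eq_cube algebra_simps)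

text \<open>
  In odd characteristic \<open>y\<^sup>2 = x\<^sup>3 + a x\<^sup>2 + b x + c\<close> is an elliptic curve exactly when the cubic has no
  multiple root, that is, when it is coprime to its derivative.
\<close>

locale separable_cubic =
  fixes a b c :: "'a::field_gcd"
  assumes two_nonzero: "(2::'a) \<noteq> 0"
    and separable: "coprime [:c, b, a, 1:] (pderiv [:c, b, a, 1:])"
begin

abbreviation t :: "'a poly" where "t \<equiv> [:0, 1:]"

definition f :: "'a poly" where "f = [:c, b, a, 1:]"

text \<open>
  Let \<open>P\<close> be the point with x-coordinate \<open>X/Z\<close> on the twist \<open>f(t) y\<^sup>2 = f(x)\<close>, and \<open>Q = (t, 1)\<close>. By the
  addition formulas the x-coordinates of \<open>P + Q\<close> and \<open>P - Q\<close> have the sum \<open>G1/G0\<close> and the product \<open>G2/G0\<close>.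
\<close>

definition G0 :: "'a poly \<Rightarrow> 'a poly \<Rightarrow> 'a poly" where
  "G0 X Z = (X - t * Z)^2"

definition G1 :: "'a poly \<Rightarrow> 'a poly \<Rightarrow> 'a poly" where
  "G1 X Z = 2 * ((X * t + [:b:] * Z) * (X + t * Z) + 2 * [:a:] * t * X * Z + 2 * [:c:] * Z^2)"

definition G2 :: "'a poly \<Rightarrow> 'a poly \<Rightarrow> 'a poly" where
  "G2 X Z = (X * t - [:b:] * Z)^2 - 4 * [:c:] * Z * (X + t * Z + [:a:] * Z)"

text \<open>
  \<open>A/B\<close> is the x-coordinate of \<open>P + Q\<close> or of \<open>P - Q\<close>, when \<open>X/Z\<close> is that of \<open>P\<close>.
\<close>

definition adjacent :: "'a poly \<Rightarrow> 'a poly \<Rightarrow> 'a poly \<Rightarrow> 'a poly \<Rightarrow> bool" where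
  "adjacent X Z A B \<longleftrightarrow> G0 X Z * A^2 - G1 X Z * A * B + G2 X Z * B^2 = 0"

text \<open>
  All points considered reduce to the point at infinity at \<open>t = \<infinity>\<close>. This explains the degree condition,
  in which \<open>Z = 0\<close> stands for the point at infinity itself. The condition
  determines the degree of \<open>G2\<close> and keeps that of \<open>G1\<close> smaller.
\<close>

definition reduced_abscissa :: "'a poly \<Rightarrow> 'a poly \<Rightarrow> bool" where
  "reduced_abscissa X Z \<longleftrightarrow> coprime X Z \<and> X \<noteq> 0 \<and> (Z = 0 \<or> degree Z < degree X)"

lemma f_eq: "f = t^3 + [:a:] * t^2 + [:b:] * t + [:c:]"
  by (simp add: f_def power3_eq_cube power2_eq_square)

lemma pderiv_f_eq: "pderiv f = 3 * t^2 + 2 * [:a:] * t + [:b:]"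
proof -
  have "pderiv f = [:3:] * t^2 + [:2:] * [:a:] * t + [:b:]"
    unfolding f_def by (simp add: pderiv_pCons power2_eq_square)
  thus ?thesis by (simp only: numeral_poly)
qed

text \<open>
  If \<open>P'\<close> is \<open>P + Q\<close> or \<open>P - Q\<close>, then \<open>P\<close> is \<open>P' - Q\<close> or \<open>P' + Q\<close>. Algebraically, the biquadratic form
  that expresses adjacency is symmetric in the two points.
\<close>

lemma adjacent_sym: "adjacent X Z A B \<longleftrightarrow> adjacent A B X Z"
proof -
  have "G0 X Z * A^2 - G1 X Z * A * B + G2 X Z * B^2 = G0 A B * X^2 - G1 A B * X * Z + G2 A B * Z^2"
    unfolding G0_def G1_def G2_def
    by (rule ring_identity_adjacent_sym)
  thus ?thesis unfolding adjacent_def by simp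
qed

lemma is_unit_four: "is_unit (4 :: 'a poly)"
proof -
  have "(4::'a) = 2 * 2" by simp
  hence "(4::'a) \<noteq> 0" using two_nonzero by (metis mult_eq_0_iff)
  moreover have "(4::'a poly) = [:4:]" by (simp only: numeral_poly)
  ultimately show ?thesis by (metis is_unit_triv)
qed

text \<open>
  The forms \<open>G0\<close>, \<open>G1\<close>, \<open>G2\<close> cannot all vanish modulo a prime. Vanishing of \<open>G0\<close> means \<open>X = t Z\<close>, and
  at such a point the other two forms specialise to \<open>4 f\<close> and \<open>f'\<^sup>2 - 4 (2t + a) f\<close> times \<open>Z\<^sup>2\<close>,
  the latter being the numerator of the duplication formula. Both can vanish only at a
  multiple root of \<open>f\<close>.
\<close>

lemma prime_not_dvd_forms:
  assumes cop: "coprime X Z" and p: "prime_elem p"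
    and d0: "p dvd G0 X Z" and d1: "p dvd G1 X Z" and d2: "p dvd G2 X Z"
  shows False
proof -
  have mult: "p dvd u * v \<Longrightarrow> p dvd u \<or> p dvd v" for u v
    using p by (simp add: prime_elem_dvd_mult_iff)
  have unit: "\<not> is_unit p" using p prime_elem_not_unit by blast
  from d0 p have d: "p dvd X - t * Z"
    unfolding G0_def using prime_elem_dvd_power by blast
  have Z: "\<not> p dvd Z"
  proof
    assume "p dvd Z"
    moreover from this d have "p dvd X"
      using dvd_add[OF d dvd_mult[of p Z t]] by simp
    ultimately show False using cop unit by (meson coprime_common_divisor)
  qed
  have "X - t * Z dvd G1 X Z - 4 * f * Z^2"
  proof
    show "G1 X Z - 4 * f * Z^2 = (X - t * Z) *
      (2 * (t * (X + 2 * t * Z) + [:b:] * Z + 2 * [:a:] * t * Z))"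
      unfolding G1_def f_eq by (rule ring_identity_G1_at_tZ)
  qed
  hence "p dvd G1 X Z - 4 * f * Z^2" using d dvd_trans by blast
  from dvd_diff[OF d1 this] have "p dvd 4 * f * Z^2" by simp
  hence "p dvd f"
    using mult Z unit is_unit_four by (metis power2_eq_square dvd_trans dvd_unit_imp_unit)
  have "X - t * Z dvd G2 X Z - (pderiv f^2 - 4 * (2 * t + [:a:]) * f) * Z^2"
  proof
    show "G2 X Z - (pderiv f^2 - 4 * (2 * t + [:a:]) * f) * Z^2 = (X - t * Z) *
      (t * (t * (X + t * Z) - 2 * [:b:] * Z) - 4 * [:c:] * Z)"
      unfolding G2_def f_eq pderiv_f_eq[unfolded f_eq] by (rule ring_identity_G2_at_tZ)
  qed
  hence "p dvd G2 X Z - (pderiv f^2 - 4 * (2 * t + [:a:]) * f) * Z^2" using d dvd_trans by blast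
  from dvd_diff[OF d2 this] have "p dvd (pderiv f^2 - 4 * (2 * t + [:a:]) * f) * Z^2" by simp
  hence "p dvd pderiv f^2 - 4 * (2 * t + [:a:]) * f"
    using mult Z by (metis power2_eq_square)
  with \<open>p dvd f\<close> have "p dvd pderiv f^2 - 4 * (2 * t + [:a:]) * f + 4 * (2 * t + [:a:]) * f"
    by (intro dvd_add dvd_mult)
  hence "p dvd pderiv f^2" by simp
  hence "p dvd pderiv f" using p prime_elem_dvd_power by blast
  with \<open>p dvd f\<close> show False using separable unit unfolding f_def by (meson coprime_common_divisor)
qed

lemma degree_G1_le:
  assumes "Z = 0 \<or> degree Z < degree X"
  shows "degree (G1 X Z) \<le> 2 * degree X + 1"
proof -
  have const: "degree (2::'a poly) = 0" by (simp add: numeral_poly)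
  have tX: "degree (X * t + [:b:] * Z) \<le> degree X + 1"
    using assms by (auto intro!: degree_add_le order.trans[OF degree_mult_le])
  have XZ: "degree (X + t * Z) \<le> degree X"
    using assms by (auto intro!: degree_add_le order.trans[OF degree_mult_le])
  have 1: "degree ((X * t + [:b:] * Z) * (X + t * Z)) \<le> 2 * degree X + 1"
    using order.trans[OF degree_mult_le add_mono[OF tX XZ]] by simp
  have atX: "degree (2 * [:a:] * t * X) \<le> degree X + 1"
    using degree_mult_le[of "2 * [:a:] * t" X] degree_mult_le[of "2 * [:a:]" t]
      degree_mult_le[of 2 "[:a:]"] const by simp
  have 2: "degree (2 * [:a:] * t * X * Z) \<le> 2 * degree X + 1"
    using assms order.trans[OF degree_mult_le add_mono[OF atX order.refl], of Z] by auto
  have 3: "degree (2 * [:c:] * Z^2) \<le> 2 * degree X + 1"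
    using assms degree_mult_le[of "2 * [:c:]" "Z^2"] degree_mult_le[of 2 "[:c:]"] const
      degree_mult_le[of Z Z] by (auto simp: power2_eq_square)
  show ?thesis unfolding G1_def
    using degree_mult_le[of 2 "(X * t + [:b:] * Z) * (X + t * Z) + 2 * [:a:] * t * X * Z + 2 * [:c:] * Z^2"]
      degree_add_le[OF degree_add_le[OF 1 2] 3] const by simp
qed

lemma degree_G2:
  assumes "X \<noteq> 0" "Z = 0 \<or> degree Z < degree X"
  shows "G2 X Z \<noteq> 0" "degree (G2 X Z) = 2 * degree X + 2"
proof -
  have const: "degree (4::'a poly) = 0" by (simp add: numeral_poly)
  have tX: "degree (X * t) = degree X + 1" using assms by (simp add: degree_mult_eq)
  hence "degree (X * t - [:b:] * Z) = degree X + 1"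
    using assms degree_mult_le[of "[:b:]" Z]
    by (subst diff_conv_add_uminus, subst degree_add_eq_left) auto
  moreover from this have "X * t - [:b:] * Z \<noteq> 0" by auto
  ultimately have 1: "degree ((X * t - [:b:] * Z)^2) = 2 * degree X + 2"
    by (simp add: degree_power_eq)
  have 2: "degree (4 * [:c:] * Z * (X + t * Z + [:a:] * Z)) < 2 * degree X + 2"
  proof -
    have "degree (X + t * Z + [:a:] * Z) \<le> degree X"
      using assms by (auto intro!: degree_add_le order.trans[OF degree_mult_le])
    moreover have "degree (4 * [:c:] * Z) \<le> degree X"
      using assms degree_mult_le[of "4 * [:c:]" Z] degree_mult_le[of 4 "[:c:]"] const by auto
    ultimately show ?thesis
      using degree_mult_le[of "4 * [:c:] * Z" "X + t * Z + [:a:] * Z"] by linarith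
  qed
  show "degree (G2 X Z) = 2 * degree X + 2"
    unfolding G2_def diff_conv_add_uminus using 1 2 by (subst degree_add_eq_left) auto
  thus "G2 X Z \<noteq> 0" by auto
qed

text \<open>
  The step from \<open>P - Q\<close> and \<open>P\<close> to \<open>P + Q\<close>. The new fraction \<open>C/D\<close> is the other root of the quadratic
  polynomial of \<open>P\<close>. A common prime divisor of \<open>C\<close> and \<open>D\<close> would divide \<open>G0 = B D\<close>, \<open>G1 = A D + B C\<close>
  and \<open>G2 = A C\<close>, so the fraction is reduced, and the degrees in \<open>G2 = A C\<close> give the recurrence.
\<close>

lemma next_abscissa:
  assumes X: "reduced_abscissa X Z" and A: "reduced_abscissa A B" and adj: "adjacent X Z A B"
  obtains C D where "reduced_abscissa C D" "adjacent X Z C D" "degree A + degree C = 2 * degree X + 2"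
proof -
  have Xd: "X \<noteq> 0" "Z = 0 \<or> degree Z < degree X" "coprime X Z"
    using X unfolding reduced_abscissa_def by auto
  have Ad: "A \<noteq> 0" "B = 0 \<or> degree B < degree A" "coprime A B"
    using A unfolding reduced_abscissa_def by auto
  obtain C D where G: "G0 X Z = B * D" "G1 X Z = A * D + B * C" "G2 X Z = A * C"
    using vieta_coprime_root[OF Ad(3,1) adj[unfolded adjacent_def]] by blast
  have C: "C \<noteq> 0" and deg: "degree A + degree C = 2 * degree X + 2"
    using degree_G2[OF Xd(1,2)] Ad(1) unfolding G(3) by (auto simp: degree_mult_eq)
  have "coprime C D"
  proof (rule ccontr)
    assume "\<not> coprime C D"
    hence "\<not> is_unit (gcd C D)" "gcd C D \<noteq> 0" using C is_unit_gcd by (blast, simp)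
    then obtain p where p: "prime p" "p dvd gcd C D"
      using prime_divisor_exists by blast
    hence "p dvd C" "p dvd D" by auto
    thus False
      using prime_not_dvd_forms[OF Xd(3), of p] p(1) unfolding G by (simp add: prime_imp_prime_elem)
  qed
  \<comment> \<open>Otherwise \<open>A D\<close> would be the leading part of \<open>G1\<close>, of degree at least \<open>deg G2 = 2 deg X + 2\<close>,
    which is more than \<open>deg G1\<close> can be.\<close>
  moreover have "D = 0 \<or> degree D < degree C"
  proof (rule ccontr)
    assume "\<not> (D = 0 \<or> degree D < degree C)"
    hence D: "D \<noteq> 0" "degree C \<le> degree D" by auto
    have "degree (A * D + B * C) = degree A + degree D"
    proof (cases "B = 0")
      case False
      have "degree (B * C) < degree (A * D)"
        using False Ad C D by (auto simp: degree_mult_eq)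
      thus ?thesis using Ad D by (simp add: degree_add_eq_left degree_mult_eq)
    qed (use Ad D in \<open>simp add: degree_mult_eq\<close>)
    thus False using degree_G1_le[OF Xd(2)] D deg unfolding G by simp
  qed
  moreover have "adjacent X Z C D"
    unfolding adjacent_def G by (simp add: algebra_simps power2_eq_square)
  ultimately show thesis using that C deg unfolding reduced_abscissa_def by blast
qed

text \<open>
  The function \<open>D\<close> is the solution of \<open>D(n) + D(n+2) = 2 D(n+1) + 2\<close> with the given first two values.
\<close>

lemma abscissa_sequence:
  assumes "reduced_abscissa X0 Z0" "reduced_abscissa X1 Z1" "adjacent X0 Z0 X1 Z1"
  defines "D \<equiv> \<lambda>n::nat. (int n)^2 + int n * (int (degree X1) - int (degree X0) - 1) + int (degree X0)"
  shows "\<exists>X Z X' Z'. reduced_abscissa X Z \<and> reduced_abscissa X' Z' \<and> adjacent X Z X' Z' \<and>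
    int (degree X) = D n \<and> int (degree X') = D (Suc n)"
proof (induction n)
  case 0
  show ?case using assms(1-3) by (intro exI[of _ X0] exI[of _ Z0] exI[of _ X1] exI[of _ Z1]) (simp add: D_def)
next
  case (Suc n)
  then obtain X Z X' Z' where IH: "reduced_abscissa X Z" "reduced_abscissa X' Z'" "adjacent X Z X' Z'"
    "int (degree X) = D n" "int (degree X') = D (Suc n)" by blast
  obtain X'' Z'' where new: "reduced_abscissa X'' Z''" "adjacent X' Z' X'' Z''"
    "degree X + degree X'' = 2 * degree X' + 2"
    using next_abscissa[OF IH(2,1)] IH(3) adjacent_sym by blast
  have "int (degree X'') = 2 * D (Suc n) + 2 - D n" using new(3) IH(4,5) by linarith
  also have "\<dots> = D (Suc (Suc n))" unfolding D_def by (simp add: power2_eq_square algebra_simps)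
  finally show ?case using new IH by blast
qed

text \<open>
  The recurrence runs in both directions: for negative \<open>m\<close> the roles of the two initial points are
  exchanged, and index \<open>n\<close> of the reversed sequence is index \<open>1 - n\<close> of the original one.
\<close>

lemma degree_form_nonneg:
  assumes "reduced_abscissa X0 Z0" "reduced_abscissa X1 Z1" "adjacent X0 Z0 X1 Z1"
  shows "0 \<le> m^2 + m * (int (degree X1) - int (degree X0) - 1) + int (degree X0)"
proof (cases "m \<ge> 0")
  case True
  show ?thesis using abscissa_sequence[OF assms, of "nat m"] True
    by (metis int_nat_eq of_nat_0_le_iff)
next
  case False
  obtain X :: "'a poly" where "int (degree X) = (int (nat (1 - m)))^2 + int (nat (1 - m)) *
      (int (degree X0) - int (degree X1) - 1) + int (degree X1)"
    using abscissa_sequence[OF assms(2,1) adjacent_sym[THEN iffD1, OF assms(3)], of "nat (1 - m)"]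
    by blast
  also have "int (nat (1 - m)) = 1 - m" using False by simp
  finally have "int (degree X) = m^2 + m * (int (degree X1) - int (degree X0) - 1) + int (degree X0)"
    by (simp add: power2_eq_square algebra_simps)
  thus ?thesis by (metis of_nat_0_le_iff)
qed

end

section \<open>Quadratic forms that are nonnegative on the integers\<close>

text \<open>
  Evaluate at an integer next to the vertex \<open>-T/2\<close>. For even \<open>T\<close> this is the vertex. For \<open>T = 2k + 1\<close>
  it yields \<open>k (k + 1) \<le> q\<close>, and as \<open>k (k + 1)\<close> is even and \<open>q\<close> is odd, the inequality is strict, which
  makes up for the quarter lost by missing the vertex.
\<close>

lemma discriminant_le:
  fixes T q :: int
  assumes "odd q" and nonneg: "\<And>m. 0 \<le> m^2 + m * T + q"
  shows "T^2 \<le> 4 * q"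
proof (cases "even T")
  case True
  then obtain k where "T = 2 * k" by auto
  thus ?thesis using nonneg[of "-k"] by (simp add: power2_eq_square algebra_simps)
next
  case False
  then obtain k where k: "T = 2 * k + 1" by (auto elim: oddE)
  have "0 \<le> q - k * (k + 1)"
    using nonneg[of "-k"] k by (simp add: power2_eq_square algebra_simps)
  moreover have "q - k * (k + 1) \<noteq> 0" using \<open>odd q\<close> by auto
  ultimately have "q - k * (k + 1) \<ge> 1" by linarith
  thus ?thesis using k by (simp add: power2_eq_square algebra_simps)
qed

section \<open>Sums of the quadratic character over a finite field\<close>

text \<open>
  Squaring is two-to-one on the nonzero elements.
\<close>

lemma card_nonzero_squares:
  assumes two: "(2::'a::finite_field) \<noteq> 0"
  shows "CARD('a) = 2 * card {x::'a. x \<noteq> 0 \<and> (\<exists>y. x = y^2)} + 1"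
proof -
  define S where "S = {x::'a. x \<noteq> 0 \<and> (\<exists>y. x = y^2)}"
  have card2: "card {y. y^2 = x} = 2" if "x \<in> S" for x
  proof -
    from that obtain w where w: "x = w^2" "w \<noteq> 0" unfolding S_def by auto
    have "w \<noteq> - w"
    proof
      assume "w = - w"
      hence "2 * w = 0" by (metis add.right_inverse mult_2)
      thus False using two w(2) by simp
    qed
    moreover have "{y. y^2 = x} = {w, - w}" using w(1) by (auto simp: power2_eq_iff)
    ultimately show ?thesis by simp
  qed
  have "UNIV - {0::'a} = (\<Union>x\<in>S. {y. y^2 = x})" unfolding S_def by auto
  hence "card (UNIV - {0::'a}) = (\<Sum>x\<in>S. card {y. y^2 = x})"
    by (simp only:) (intro card_UN_disjoint, auto)
  also have "\<dots> = 2 * card S" using card2 by simp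
  finally have "CARD('a) - 1 = 2 * card S" by (simp add: card_Diff_singleton)
  moreover have "CARD('a) > 0" by simp
  ultimately show ?thesis unfolding S_def by linarith
qed

lemma quadratic_character_cases: "quadratic_character x \<in> {-1, 0, 1}"
  unfolding quadratic_character_def by auto

lemma quadratic_character_eq_0_iff [simp]: "quadratic_character x = 0 \<longleftrightarrow> x = 0"
  unfolding quadratic_character_def by auto

lemma quadratic_character_square: "y \<noteq> 0 \<Longrightarrow> quadratic_character (y^2) = 1"
  unfolding quadratic_character_def by auto

text \<open>
  The \<open>h\<close> nonzero squares are roots of \<open>x^h - 1\<close>, and this polynomial has no room for other roots.
\<close>

lemma euler_criterion_finite_field:
  fixes x :: "'a::finite_field"
  assumes two: "(2::'a) \<noteq> 0" and h: "CARD('a) = 2 * h + 1"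
  shows "of_int (quadratic_character x) = x ^ h"
proof -
  define S where "S = {x::'a. x \<noteq> 0 \<and> (\<exists>y. x = y^2)}"
  have card_S: "card S = h" using card_nonzero_squares[OF two] h unfolding S_def by simp
  have "CARD('a) \<ge> card {0, 1::'a}" by (intro card_mono) auto
  hence h_pos: "h > 0" using h by simp
  have fermat: "y ^ (2 * h) = 1" if "y \<noteq> 0" for y :: 'a
    using finite_field_power_card_eq_same[of y] that unfolding h by simp
  define g :: "'a poly" where "g = monom 1 h - 1"
  have coeff_g: "coeff g h = 1" unfolding g_def using h_pos by simp
  hence g_nz: "g \<noteq> 0" by auto
  have deg_g: "degree g \<le> h" unfolding g_def by (intro degree_diff_le) (auto simp: degree_monom_le)
  have roots_g: "{x. poly g x = 0} = {x. x ^ h = 1}" unfolding g_def by (simp add: poly_monom)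
  have "S \<subseteq> {x. x ^ h = 1}"
    unfolding S_def using fermat by (auto simp flip: power_mult)
  moreover have "card {x::'a. x ^ h = 1} \<le> card S"
    using card_poly_roots_bound[OF g_nz] deg_g card_S unfolding roots_g by simp
  ultimately have S_eq: "S = {x. x ^ h = 1}" by (intro card_seteq) auto
  show ?thesis
  proof (cases "x = 0")
    case True
    thus ?thesis using h_pos by (simp add: quadratic_character_def)
  next
    case nz: False
    have "(x ^ h)^2 = 1" using fermat[OF nz] by (simp add: power_mult[symmetric] mult.commute)
    hence "x ^ h = 1 \<or> x ^ h = -1" by (simp add: power2_eq_1_iff)
    moreover have "x \<in> S \<longleftrightarrow> x ^ h = 1" using S_eq by auto
    ultimately show ?thesis using nz unfolding S_def quadratic_character_def by auto
  qed
qed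

lemma quadratic_character_mult:
  fixes x y :: "'a::finite_field"
  assumes two: "(2::'a) \<noteq> 0"
  shows "quadratic_character (x * y) = quadratic_character x * quadratic_character y"
proof -
  obtain h where h: "CARD('a) = 2 * h + 1" using card_nonzero_squares[OF two] by blast
  have "(of_int (quadratic_character (x * y)) :: 'a) = of_int (quadratic_character x * quadratic_character y)"
    by (simp add: euler_criterion_finite_field[OF two h] power_mult_distrib)
  moreover have "(1::'a) \<noteq> -1" using two by (metis one_add_one add.right_inverse)
  ultimately show ?thesis
    using quadratic_character_cases[of x] quadratic_character_cases[of y]
      quadratic_character_cases[of "x * y"] by auto
qed

lemma sum_quadratic_character:
  assumes two: "(2::'a::finite_field) \<noteq> 0"
  shows "(\<Sum>x\<in>(UNIV::'a set). quadratic_character x) = 0"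
proof -
  define S where "S = {x::'a. x \<noteq> 0 \<and> (\<exists>y. x = y^2)}"
  have eq: "quadratic_character x = 2 * of_bool (x \<in> S) - 1 + of_bool (x = 0)" for x :: 'a
    unfolding S_def quadratic_character_def by auto
  have "(\<Sum>x\<in>(UNIV::'a set). quadratic_character x) = 2 * int (card S) - int CARD('a) + 1"
    unfolding eq by (simp add: sum.distrib sum_subtractf flip: sum_distrib_left)
  thus ?thesis using card_nonzero_squares[OF two] unfolding S_def by simp
qed

lemma sum_quadratic_character_linear:
  fixes k l :: "'a::finite_field"
  assumes two: "(2::'a) \<noteq> 0" and "k \<noteq> 0"
  shows "(\<Sum>x\<in>UNIV. quadratic_character (k * x + l)) = 0"
proof -
  have "(\<Sum>x\<in>UNIV. quadratic_character (k * x + l)) = (\<Sum>x\<in>UNIV. quadratic_character (x::'a))"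
    by (rule sum.reindex_bij_witness[of _ "\<lambda>y. (y - l) / k" "\<lambda>x. k * x + l"]) (use assms in auto)
  thus ?thesis using sum_quadratic_character[OF two] by simp
qed

text \<open>
  For \<open>x \<noteq> r\<close>, dividing by the square \<open>(x - r)\<^sup>2\<close> replaces the argument by \<open>(x - s) / (x - r)\<close>. This Moebius
  transformation takes every value except \<open>1\<close>, its value at infinity.
\<close>

lemma sum_quadratic_character_quadratic:
  fixes r s :: "'a::finite_field"
  assumes two: "(2::'a) \<noteq> 0" and "r \<noteq> s"
  shows "(\<Sum>x\<in>UNIV. quadratic_character ((x - r) * (x - s))) = -1"
proof -
  have "(\<Sum>x\<in>UNIV. quadratic_character ((x - r) * (x - s))) =
    (\<Sum>x\<in>UNIV - {r}. quadratic_character ((x - r) * (x - s)))"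
    by (intro sum.mono_neutral_right) auto
  also have "\<dots> = (\<Sum>y\<in>UNIV - {1::'a}. quadratic_character y)"
  proof (rule sum.reindex_bij_witness[of _ "\<lambda>y. r + (r - s) / (y - 1)" "\<lambda>x. (x - s) / (x - r)"], goal_cases)
    case (3 y)
    hence "r + (r - s) / (y - 1) - s = y * ((r - s) / (y - 1))"
      by (simp add: field_simps)
    thus ?case using 3 \<open>r \<noteq> s\<close> by simp
  next
    case (5 x)
    have "(x - r) * (x - s) = (x - r)^2 * ((x - s) / (x - r))"
      using 5 by (simp add: power2_eq_square)
    thus ?case using 5 quadratic_character_square[of "x - r"]
      by (simp only: quadratic_character_mult[OF two]) simp
  qed (use assms in \<open>auto simp: field_simps\<close>)
  also have "\<dots> = -1"
    using sum_quadratic_character[OF two] sum.remove[of UNIV "1::'a" quadratic_character]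
      quadratic_character_square[of "1::'a"] by simp
  finally show ?thesis .
qed

text \<open>
  The condition \<open>15 \<noteq> 0\<close> says that \<open>1/4\<close> and \<open>4\<close> are different, so that \<open>(x - 1/4) (x - 4)\<close> is not a
  square and its character sum is \<open>-1\<close>.
\<close>

lemma card_eq_character_sum:
  assumes two: "(2::'a::finite_field) \<noteq> 0" and fifteen: "(15::'a) \<noteq> 0"
  shows "8 * int (card {x::'a. x \<noteq> 0 \<and> quadratic_character x = - 1 \<and>
        quadratic_character (1 - 4 * x) = - 1 \<and> quadratic_character (1 - 4 / x) = - 1}) =
     int CARD('a) + 1 + (\<Sum>z\<in>(UNIV::'a set). quadratic_character (z * (z - 4) * (1 - 4 * z)))"
proof -
  let ?\<chi> = "quadratic_character :: 'a \<Rightarrow> int"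
  define A where "A = {x::'a. x \<noteq> 0 \<and> ?\<chi> x = - 1 \<and> ?\<chi> (1 - 4 * x) = - 1 \<and> ?\<chi> (1 - 4 / x) = - 1}"
  define T where "T = (\<Sum>z\<in>UNIV. ?\<chi> (z * (z - 4) * (1 - 4 * z)))"
  define e where "e = ?\<chi> (-4)"
  note mult = quadratic_character_mult[OF two]
  have four_eq: "(4::'a) = 2^2" by simp
  have four: "(4::'a) \<noteq> 0" using two unfolding four_eq by (rule power_not_zero)
  have quarter: "(1/4::'a) = (1/2)^2" by (simp add: power_divide)
  have "(1/4::'a) \<noteq> 4"
  proof
    assume "(1/4::'a) = 4"
    hence "(1::'a) = 16" using four by (simp add: field_simps)
    hence "(16::'a) - 1 = 0" by simp
    thus False using fifteen by simp
  qed
  \<comment> \<open>At \<open>x = 0\<close>, where \<open>4 / x\<close> has only its conventional value, the factor \<open>1 - \<chi> 1\<close> is zero.\<close>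
  have indicator: "(1 - ?\<chi> x) * (1 - ?\<chi> (1 - 4 * x)) * (1 - ?\<chi> (x * (x - 4))) = 8 * of_bool (x \<in> A)" for x
  proof (cases "x = 0")
    case True
    thus ?thesis using quadratic_character_square[of "1::'a"] unfolding A_def by simp
  next
    case nz: False
    have "x * (x - 4) = x^2 * (1 - 4 / x)" using nz by (simp add: field_simps power2_eq_square)
    hence w: "?\<chi> (x * (x - 4)) = ?\<chi> (1 - 4 / x)"
      using quadratic_character_square[OF nz] by (simp only: mult)
    show ?thesis
    proof (cases "?\<chi> x = -1")
      case True
      have nsq: "x \<noteq> y^2" for y
        using True nz quadratic_character_square[of y] by auto
      have "x \<noteq> 4" unfolding four_eq by (rule nsq)
      moreover have "x \<noteq> 1/4" unfolding quarter by (rule nsq)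
      ultimately have "1 - 4 * x \<noteq> 0" "1 - 4 / x \<noteq> 0" using nz four by (auto simp: field_simps)
      thus ?thesis using True nz quadratic_character_cases[of "1 - 4 * x"]
          quadratic_character_cases[of "1 - 4 / x"] unfolding w A_def by auto
    next
      case False
      thus ?thesis using nz quadratic_character_cases[of x] unfolding A_def by auto
    qed
  qed
  have factor: "(1 - 4 * x) = (-4) * (x - 1/4)" for x :: 'a
    using four by (simp add: field_simps)
  have s_u: "(\<Sum>x\<in>UNIV. ?\<chi> x) = 0" by (rule sum_quadratic_character[OF two])
  have s_v: "(\<Sum>x\<in>UNIV. ?\<chi> (1 - 4 * x)) = 0"
    using sum_quadratic_character_linear[OF two, of "-4" 1] four by simp
  have s_w: "(\<Sum>x\<in>UNIV. ?\<chi> (x * (x - 4))) = -1"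
    using sum_quadratic_character_quadratic[OF two, of 0 4] four by simp
  have s_uv: "(\<Sum>x\<in>UNIV. ?\<chi> x * ?\<chi> (1 - 4 * x)) = - e"
  proof -
    have "?\<chi> x * ?\<chi> (1 - 4 * x) = e * ?\<chi> ((x - 0) * (x - 1/4))" for x
      unfolding factor mult e_def by simp
    thus ?thesis using sum_quadratic_character_quadratic[OF two, of 0 "1/4"] four
      by (simp flip: sum_distrib_left)
  qed
  have e_0: "x = 0 \<Longrightarrow> ?\<chi> (x - 4) = e" for x unfolding e_def by simp
  \<comment> \<open>Where \<open>\<chi> x\<close> meets \<open>\<chi> (x * (x - 4))\<close>, a square \<open>x\<^sup>2\<close> disappears from the argument, except at \<open>x = 0\<close>, where the term
    vanishes. The correction for this one point is \<open>\<chi>(-4)\<close> each time.\<close>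
  have s_uw: "(\<Sum>x\<in>UNIV. ?\<chi> x * ?\<chi> (x * (x - 4))) = - e"
  proof -
    have "?\<chi> x * ?\<chi> (x * (x - 4)) = ?\<chi> (1 * x + - 4) - (if x = 0 then e else 0)" for x
      using quadratic_character_square[of x] e_0[of x]
      by (cases "x = 0") (simp_all add: mult power2_eq_square flip: mult.assoc)
    thus ?thesis using sum_quadratic_character_linear[OF two, of 1 "-4"]
      by (simp add: sum_subtractf)
  qed
  have s_vw: "(\<Sum>x\<in>UNIV. ?\<chi> (1 - 4 * x) * ?\<chi> (x * (x - 4))) = T"
    unfolding T_def by (simp add: mult mult_ac)
  have s_uvw: "(\<Sum>x\<in>UNIV. ?\<chi> x * ?\<chi> (1 - 4 * x) * ?\<chi> (x * (x - 4))) = - 2 * e"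
  proof -
    have "?\<chi> x * ?\<chi> (1 - 4 * x) * ?\<chi> (x * (x - 4)) =
      e * ?\<chi> ((x - 1/4) * (x - 4)) - (if x = 0 then e else 0)" for x
    proof (cases "x = 0")
      case True
      thus ?thesis using four quadratic_character_square[of "1::'a"] by simp
    next
      case False
      thus ?thesis using quadratic_character_square[of x]
        unfolding factor mult e_def by (simp add: power2_eq_square mult mult_ac)
    qed
    thus ?thesis using sum_quadratic_character_quadratic[OF two \<open>1/4 \<noteq> 4\<close>]
      by (simp add: sum_subtractf flip: sum_distrib_left)
  qed
  have "8 * int (card A) = (\<Sum>x\<in>UNIV. 8 * of_bool (x \<in> A))"
    by (simp flip: sum_distrib_left)
  also have "\<dots> = (\<Sum>x\<in>UNIV. 1 - ?\<chi> x - ?\<chi> (1 - 4 * x) - ?\<chi> (x * (x - 4))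
      + ?\<chi> x * ?\<chi> (1 - 4 * x) + ?\<chi> x * ?\<chi> (x * (x - 4)) + ?\<chi> (1 - 4 * x) * ?\<chi> (x * (x - 4))
      - ?\<chi> x * ?\<chi> (1 - 4 * x) * ?\<chi> (x * (x - 4)))"
    unfolding indicator[symmetric] by (intro sum.cong refl) (simp only: algebra_simps)
  also have "\<dots> = int CARD('a) + 1 + T"
    unfolding sum.distrib sum_subtractf s_u s_v s_w s_uv s_uw s_vw s_uvw by simp
  finally show ?thesis unfolding A_def T_def .
qed

section \<open>Polynomials with a prescribed set of simple roots\<close>

definition root_product :: "'a::field set \<Rightarrow> 'a poly" where
  "root_product S = (\<Prod>r\<in>S. [:- r, 1:])"

lemma degree_root_product: "finite S \<Longrightarrow> degree (root_product S) = card S"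
  unfolding root_product_def by (subst degree_prod_eq_sum_degree) auto

lemma root_product_nonzero: "finite S \<Longrightarrow> root_product S \<noteq> 0"
  unfolding root_product_def by simp

lemma poly_root_product_eq_0_iff:
  "finite S \<Longrightarrow> poly (root_product S) x = 0 \<longleftrightarrow> x \<in> S"
  unfolding root_product_def by (auto simp: poly_prod)

lemma root_product_Un:
  "finite S \<Longrightarrow> finite S' \<Longrightarrow> S \<inter> S' = {} \<Longrightarrow> root_product (S \<union> S') = root_product S * root_product S'"
  unfolding root_product_def by (rule prod.union_disjoint)

text \<open>
  Different linear factors do not interfere: after removing one root from \<open>g\<close>, the other elements of
  \<open>S\<close> are still roots of the quotient.
\<close>

lemma root_product_dvd:
  assumes "finite S" "\<And>r. r \<in> S \<Longrightarrow> poly g r = 0"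
  shows "root_product S dvd g"
  using assms
proof (induction S arbitrary: g)
  case empty
  show ?case by (simp add: root_product_def)
next
  case (insert r S)
  then obtain g' where g: "g = [:- r, 1:] * g'"
    by (metis insertI1 poly_eq_0_iff_dvd dvdE)
  have "root_product S dvd g'"
  proof (rule insert.IH)
    fix s assume "s \<in> S"
    hence "poly g s = 0" "s \<noteq> r" using insert by auto
    thus "poly g' s = 0" unfolding g by simp
  qed
  hence "[:- r, 1:] * root_product S dvd [:- r, 1:] * g'" by (rule mult_dvd_mono[OF dvd_refl])
  thus ?case unfolding g root_product_def prod.insert[OF insert.hyps] .
qed

lemma coprime_root_product:
  fixes g :: "'a::field_gcd poly"
  assumes "\<And>r. r \<in> S \<Longrightarrow> poly g r \<noteq> 0"
  shows "coprime g (root_product S)"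
  unfolding root_product_def
proof (rule prod_coprime_right)
  fix r assume "r \<in> S"
  hence "\<not> [:- r, 1:] dvd g" using assms poly_eq_0_iff_dvd by blast
  moreover have "prime_elem [:- r, 1:]" by (rule prime_elem_linear_field_poly) simp
  ultimately show "coprime g [:- r, 1:]"
    using prime_elem_imp_coprime coprime_commute by blast
qed

text \<open>
  Both sides are monic of degree \<open>CARD('a)\<close> and vanish on the whole field, so their difference has more
  roots than its degree allows.
\<close>

lemma root_product_UNIV:
  "root_product (UNIV :: 'a::finite_field set) = [:0, 1:] ^ CARD('a) - [:0, 1:]"
proof (rule poly_eqI_degree_lead_coeff[where A = UNIV and n = "CARD('a)"])
  have "CARD('a) \<ge> card {0, 1::'a}" by (intro card_mono) auto
  hence q: "CARD('a) > 1" by simp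
  have lead: "coeff (root_product (UNIV::'a set)) (CARD('a)) = 1"
    using lead_coeff_prod[of "\<lambda>r. [:- r, 1:]" "UNIV::'a set"] degree_root_product[of "UNIV::'a set"]
    unfolding root_product_def by simp
  show "coeff (root_product (UNIV :: 'a set)) (CARD('a)) = coeff ([:0, 1:] ^ CARD('a) - [:0, 1:]) (CARD('a))"
    unfolding lead using q by (simp add: coeff_pCons flip: monom_altdef split: nat.split)
  show "degree ([:0, 1:] ^ CARD('a) - [:0, 1::'a:]) \<le> CARD('a)"
    using q by (intro degree_diff_le) (auto simp: degree_power_eq)
  fix x :: 'a
  show "poly (root_product UNIV) x = poly ([:0, 1:] ^ CARD('a) - [:0, 1:]) x"
    using poly_root_product_eq_0_iff[of UNIV x] by (simp add: poly_power finite_field_power_card_eq_same)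
qed (auto simp: degree_root_product)

section \<open>The Hasse bound for cubics\<close>

text \<open>
  The next three identities are about the point \<open>P\<^sub>0 - Q\<close>, where \<open>P\<^sub>0 = (X, w)\<close>. The chord through \<open>P\<^sub>0\<close>
  and \<open>-Q = (t, -1)\<close> has slope \<open>(w + 1) / (X - t)\<close>, so the x-coordinate of \<open>P\<^sub>0 - Q\<close> has the numerator
  \<open>F (w + 1)\<^sup>2 - (X + t + a) (X - t)\<^sup>2\<close> over \<open>(X - t)\<^sup>2\<close>. The first identity isolates the square root
  \<open>2 F w\<close> of a quarter of the discriminant of the quadratic polynomial of \<open>P\<^sub>0\<close>, the second exhibits the
  leading term \<open>X\<^sup>2 t\<close> of the numerator, and the third computes the discriminant.
\<close>

lemma ring_identity_numerator:
  fixes X t a b c w F :: "'r::idom"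
  assumes F: "F = t^3 + a * t^2 + b * t + c" and FX: "F * w^2 = X^3 + a * X^2 + b * X + c"
  shows "F * (w + 1)^2 - (X + t + a) * (X - t)^2 =
    ((X * t + b) * (X + t) + 2 * a * t * X + 2 * c) + 2 * F * w"
proof -
  have "F * (w + 1)^2 = F * w^2 + 2 * F * w + F" by (simp add: power2_eq_square algebra_simps)
  thus ?thesis unfolding FX unfolding F by (simp add: power2_eq_square power3_eq_cube algebra_simps)
qed

lemma ring_identity_leading_term:
  fixes X t a b c W :: "'r::idom"
  shows "((X * t + b) * (X + t) + 2 * a * t * X + 2 * c) + W =
    X^2 * t + ((t^2 + 2 * a * t + b) * X + (b * t + 2 * c) + W)"
  by (simp add: power2_eq_square algebra_simps)

lemma ring_identity_discriminant:
  fixes X t a b c :: "'r::idom"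
  shows "((X * t + b) * (X + t) + 2 * a * t * X + 2 * c)^2
     - 4 * (t^3 + a * t^2 + b * t + c) * (X^3 + a * X^2 + b * X + c) =
     ((X * t - b)^2 - 4 * c * (X + t + a)) * (X - t)^2"
  by (simp add: power2_eq_square power3_eq_cube algebra_simps)

text \<open>
  Hasse's theorem for \<open>y\<^sup>2 = f(x)\<close>: the number of affine points is \<open>CARD('a)\<close> plus the sum bounded here. The
  proof applies \<open>degree_form_nonneg\<close> to \<open>P\<^sub>0\<close> and \<open>P\<^sub>0 - Q\<close>. The hypothesis \<open>card_power\<close>, for which
  \<open>k = 1\<close> is the case of a prime field, is what makes raising to the power \<open>CARD('a)\<close> additive, so that
  \<open>P\<^sub>0\<close> lies on the twisted curve.
\<close>

theorem hasse_bound: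
  fixes a b c :: "'a::{finite_field,field_gcd}"
  assumes "separable_cubic a b c" and card_power: "CARD('a) = CHAR('a) ^ k"
  shows "(\<Sum>z\<in>UNIV. quadratic_character (poly [:c, b, a, 1:] z))^2 \<le> 4 * int CARD('a)"
proof -
  interpret separable_cubic a b c by fact
  define q where "q = CARD('a)"
  obtain h where h: "q = 2 * h + 1" using card_nonzero_squares[OF two_nonzero] unfolding q_def by blast
  have "CARD('a) \<ge> card {0, 1::'a}" by (intro card_mono) auto
  hence h_pos: "h > 0" using h unfolding q_def by simp
  define \<chi> where "\<chi> z = quadratic_character (poly f z)" for z
  have euler: "poly f z ^ h = of_int (\<chi> z)" for z
    unfolding \<chi>_def using euler_criterion_finite_field[OF two_nonzero] h unfolding q_def by metis
  define P M Z where "P = {z. \<chi> z = 1}" and "M = {z. \<chi> z = -1}" and "Z = {z. \<chi> z = 0}"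
  have \<chi>_cases: "\<chi> z = 1 \<or> \<chi> z = -1 \<or> \<chi> z = 0" for z
    using quadratic_character_cases[of "poly f z"] unfolding \<chi>_def by auto
  have part: "UNIV = P \<union> (M \<union> Z)" "P \<inter> (M \<union> Z) = {}" "M \<inter> Z = {}"
    using \<chi>_cases unfolding P_def M_def Z_def by auto
  have q_sum: "q = card P + (card M + card Z)"
    unfolding q_def part(1) using part(2,3) by (simp add: card_Un_disjoint)
  have sum_\<chi>: "(\<Sum>z\<in>UNIV. \<chi> z) = int (card P) - int (card M)"
  proof -
    have "(\<Sum>z\<in>UNIV. \<chi> z) = (\<Sum>z\<in>P. \<chi> z) + ((\<Sum>z\<in>M. \<chi> z) + (\<Sum>z\<in>Z. \<chi> z))"
      unfolding part(1) using part(2,3) by (simp add: sum.union_disjoint)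
    thus ?thesis by (simp add: P_def M_def Z_def)
  qed
  define X w where "X = t ^ q" and "w = f ^ h"
  have Frobenius: "(u + v) ^ q = u ^ q + v ^ q" for u v :: "'a poly"
    by (rule freshmans_dream'[where n = k]) (simp_all add: q_def card_power)
  have const: "[:u:] ^ q = [:u:]" for u :: 'a
    by (simp add: poly_const_pow finite_field_power_card_eq_same q_def)
  \<comment> \<open>The Frobenius point lies on the twist: \<open>f(t) w\<^sup>2 = f(t)^q = f(t^q)\<close>.\<close>
  have f_X: "f * w^2 = X^3 + [:a:] * X^2 + [:b:] * X + [:c:]"
  proof -
    have "f * w^2 = f ^ q" unfolding w_def h by (simp add: power_mult[symmetric] mult.commute)
    also have "\<dots> = X^3 + [:a:] * X^2 + [:b:] * X + [:c:]"
      unfolding f_eq Frobenius power_mult_distrib const X_def by (simp add: mult.commute flip: power_mult)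
    finally show ?thesis .
  qed
  define S N where "S = (X * t + [:b:]) * (X + t) + 2 * [:a:] * t * X + 2 * [:c:]"
    and "N = S + 2 * f * w"
  define Y where "Y = X + t + [:a:]"
  have N_eq: "N = f * (w + 1)^2 - Y * (X - t)^2"
    unfolding N_def S_def Y_def by (rule ring_identity_numerator[OF f_eq f_X, symmetric])
  \<comment> \<open>The roots of the quadratic polynomial of \<open>P\<^sub>0\<close> are \<open>(S + 2 f w) / (X - t)\<^sup>2\<close> and
    \<open>(S - 2 f w) / (X - t)\<^sup>2\<close>.\<close>
  have adj: "N^2 - G1 X 1 * N + G2 X 1 * (X - t)^2 = 0"
  proof -
    have "G1 X 1 = 2 * S" unfolding G1_def S_def by simp
    hence "N^2 - G1 X 1 * N = 4 * f * (f * w^2) - S^2"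
      unfolding N_def by (simp add: power2_eq_square algebra_simps)
    moreover have "G2 X 1 = (X * t - [:b:])^2 - 4 * [:c:] * (X + t + [:a:])"
      unfolding G2_def by (simp only: mult_1_right)
    moreover have "S^2 - 4 * f * (f * w^2) =
        ((X * t - [:b:])^2 - 4 * [:c:] * (X + t + [:a:])) * (X - t)^2"
      unfolding f_X unfolding S_def f_eq by (rule ring_identity_discriminant)
    moreover have "u - v + (v - u) = 0" for u v :: "'a poly" by simp
    ultimately show ?thesis by metis
  qed
  have "X - t = root_product UNIV" unfolding X_def q_def root_product_UNIV ..
  also have "\<dots> = root_product P * (root_product M * root_product Z)"
    unfolding part(1) using part(2,3) by (simp only: root_product_Un finite)
  finally have X_t: "X - t = root_product P * (root_product M * root_product Z)" .
  have "root_product M dvd w + 1"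
    by (rule root_product_dvd) (auto simp: w_def euler M_def)
  then obtain V where V: "w + 1 = root_product M * V" ..
  have "root_product Z dvd f"
    by (rule root_product_dvd) (auto simp: Z_def \<chi>_def)
  then obtain U where U: "f = root_product Z * U" ..
  \<comment> \<open>\<open>g\<close> is the part that cancels between the numerator \<open>N\<close> and the denominator \<open>(X - t)\<^sup>2\<close>: every
    nonsquare contributes both of its factors, since \<open>w + 1\<close> vanishes there, and every zero of \<open>f\<close> one.\<close>
  define g A B where "g = root_product M^2 * root_product Z"
    and "A = U * V^2 - Y * (root_product P^2 * root_product Z)"
    and "B = root_product P^2 * root_product Z"
  have gA: "N = g * A"
    unfolding N_eq V X_t U g_def A_def by (simp add: power2_eq_square algebra_simps)
  have gB: "(X - t)^2 = g * B"
    unfolding X_t g_def B_def by (simp add: power2_eq_square algebra_simps)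
  have g: "g \<noteq> 0" unfolding g_def by (simp add: root_product_nonzero)
  \<comment> \<open>Nothing else cancels: \<open>w + 1\<close> is \<open>2\<close> or \<open>1\<close> at the remaining points, and the zeros of \<open>f\<close> are simple.\<close>
  have A_root: "poly A r \<noteq> 0" if r: "r \<in> P \<union> Z" for r
  proof -
    have "poly (root_product P^2 * root_product Z) r = 0"
      using r poly_root_product_eq_0_iff[of P r] poly_root_product_eq_0_iff[of Z r] by auto
    hence "poly A r = poly U r * poly V r^2" unfolding A_def by simp
    moreover have "poly V r \<noteq> 0"
    proof -
      have "poly (w + 1) r \<noteq> 0"
        using r two_nonzero by (auto simp: w_def euler P_def Z_def)
      thus ?thesis unfolding V by auto
    qed
    moreover have "poly U r \<noteq> 0"
    proof
      assume 0: "poly U r = 0"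
      hence "poly f r = 0" unfolding U by simp
      hence "\<chi> r = 0" by (simp add: \<chi>_def)
      hence "poly (root_product Z) r = 0" by (simp add: poly_root_product_eq_0_iff Z_def)
      hence "poly (pderiv f) r = 0" unfolding U using 0 by (simp add: pderiv_mult)
      with \<open>poly f r = 0\<close> have "[:- r, 1:] dvd f" "[:- r, 1:] dvd pderiv f"
        by (simp_all add: poly_eq_0_iff_dvd)
      hence "is_unit [:- r, 1:]"
        using separable unfolding f_def by (meson coprime_common_divisor)
      thus False by (simp add: is_unit_iff_degree)
    qed
    ultimately show ?thesis by simp
  qed
  have "coprime A B"
    unfolding B_def using A_root by (simp add: coprime_root_product)
  have q: "q > 1" using h h_pos by simp
  have deg_X: "degree X = q" unfolding X_def by (simp add: degree_power_eq)
  have "X \<noteq> 0" using deg_X q by auto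
  have deg_N: "degree N = 2 * q + 1" and "N \<noteq> 0"
  proof -
    define R where "R = [:b, 2 * a, 1:] * X + [:2 * c, b:] + [:2:] * f * w"
    have two_const: "(2::'a poly) = [:2:]" by (simp only: numeral_poly)
    have "[:b, 2 * a, 1:] = t^2 + 2 * [:a:] * t + [:b:]" "[:2 * c, b:] = [:b:] * t + 2 * [:c:]"
      unfolding two_const by (simp_all add: power2_eq_square)
    hence N: "N = X^2 * t + R"
      unfolding N_def S_def R_def two_const[symmetric] by (simp only: ring_identity_leading_term)
    have 1: "degree (X^2 * t) = 2 * q + 1"
      using \<open>X \<noteq> 0\<close> by (simp add: degree_mult_eq degree_power_eq deg_X)
    have deg_f: "degree f = 3" unfolding f_def by simp
    hence "f \<noteq> 0" by auto
    hence deg_w: "degree w = 3 * h" unfolding w_def using deg_f by (simp add: degree_power_eq)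
    have "degree ([:2:] * f) \<le> 3"
      using degree_mult_le[of "[:2:]" f] unfolding deg_f degree_pCons_0 by linarith
    hence "degree ([:2:] * f * w) \<le> 3 + 3 * h"
      using degree_mult_le[of "[:2:] * f" w] unfolding deg_w by linarith
    hence "degree ([:2:] * f * w) < 2 * q + 1"
      using h h_pos by linarith
    moreover have "degree ([:b, 2 * a, 1:] * X) < 2 * q + 1"
    proof -
      have "degree [:b, 2 * a, 1:] \<le> 2" by simp
      thus ?thesis using degree_mult_le[of "[:b, 2 * a, 1:]" X] deg_X q by linarith
    qed
    moreover have "degree [:2 * c, b:] < 2 * q + 1" using q by simp
    ultimately have "degree R < 2 * q + 1" unfolding R_def by (intro degree_add_less)
    thus "degree N = 2 * q + 1" unfolding N using 1 by (subst degree_add_eq_left) auto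
    thus "N \<noteq> 0" by auto
  qed
  have A: "A \<noteq> 0" using \<open>N \<noteq> 0\<close> unfolding gA by auto
  have "degree g = 2 * card M + card Z"
    unfolding g_def by (simp add: degree_mult_eq degree_power_eq root_product_nonzero degree_root_product)
  \<comment> \<open>With \<open>q = card P + card M + card Z\<close> this is \<open>q + 1 + (card P - card M)\<close>, that is, \<open>q + 1 + T\<close>.\<close>
  hence deg_A: "degree A = 2 * card P + card Z + 1"
    using deg_N g A q_sum unfolding gA by (simp add: degree_mult_eq)
  have deg_B: "degree B = 2 * card P + card Z"
    unfolding B_def by (simp add: degree_mult_eq degree_power_eq root_product_nonzero degree_root_product)
  have red_A: "reduced_abscissa A B"
    unfolding reduced_abscissa_def using \<open>coprime A B\<close> A deg_A deg_B by simp
  have red_X: "reduced_abscissa X 1"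
    unfolding reduced_abscissa_def using \<open>X \<noteq> 0\<close> deg_X q by simp
  have adj_XA: "adjacent X 1 A B"
  proof -
    have "g^2 * (G0 X 1 * A^2 - G1 X 1 * A * B + G2 X 1 * B^2)
      = (X - t)^2 * (N^2 - G1 X 1 * N + G2 X 1 * (X - t)^2)"
      unfolding G0_def gA mult_1_right gB by (simp add: power2_eq_square algebra_simps)
    thus ?thesis using adj g unfolding adjacent_def by simp
  qed
  define T where "T = (\<Sum>z\<in>UNIV. \<chi> z)"
  have "T^2 \<le> 4 * int q"
  proof (rule discriminant_le)
    show "odd (int q)" using h by simp
    have "int (degree A) - int (degree X) - 1 = T"
      unfolding T_def sum_\<chi> deg_A deg_X using q_sum by simp
    thus "0 \<le> m^2 + m * T + int q" for m
      using degree_form_nonneg[OF red_X red_A adj_XA, of m] deg_X by simp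
  qed
  thus ?thesis unfolding T_def \<chi>_def f_def q_def .
qed

section \<open>The count for the prime field\<close>

lemma two_and_fifteen_nonzero_mod_ring:
  assumes "CARD('p::prime_card) \<ge> 11"
  shows "(2::'p mod_ring) \<noteq> 0" "(15::'p mod_ring) \<noteq> 0"
proof -
  have prime: "prime CARD('p)" by (rule prime_card)
  have zero_iff: "(of_nat n :: 'p mod_ring) = 0 \<longleftrightarrow> CARD('p) dvd n" for n
    by (simp add: of_nat_eq_0_iff_char_dvd)
  have "\<not> CARD('p) dvd 2" using assms by (auto dest: dvd_imp_le)
  thus "(2::'p mod_ring) \<noteq> 0" using zero_iff[of 2] by simp
  have "\<not> CARD('p) dvd 3" "\<not> CARD('p) dvd 5" using assms by (auto dest: dvd_imp_le)
  hence "\<not> CARD('p) dvd 3 * 5" using prime prime_dvd_mult_iff by blast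
  thus "(15::'p mod_ring) \<noteq> 0" using zero_iff[of 15] by simp
qed

text \<open>
  The cubic is \<open>u (u + 1) (u + 16)\<close>, and its derivative takes the values \<open>16\<close>, \<open>-15\<close> and \<open>240\<close> at the
  roots \<open>0\<close>, \<open>-1\<close> and \<open>-16\<close>.
\<close>

lemma separable_cubic_17_16_0:
  assumes two: "(2::'a::field_gcd) \<noteq> 0" and fifteen: "(15::'a) \<noteq> 0"
  shows "separable_cubic 17 16 (0::'a)"
proof
  have distinct: "(0::'a) \<noteq> -1" "(0::'a) \<noteq> -16" "(-1::'a) \<noteq> -16"
  proof -
    have "(16::'a) = 2 ^ 4" by simp
    thus "(0::'a) \<noteq> -16" using two by (metis neg_0_equal_iff_equal power_not_zero)
    show "(-1::'a) \<noteq> -16"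
    proof
      assume "(-1::'a) = -16"
      hence "(16::'a) - 1 = 0" by simp
      thus False using fifteen by simp
    qed
  qed simp
  have factored: "[:0, 16, 17, 1::'a:] = root_product {0, -1, -16}"
    using distinct unfolding root_product_def by simp
  have sixteen: "(16::'a) \<noteq> 0" using distinct(2) by simp
  have "(240::'a) = 16 * 15" by simp
  hence "(240::'a) \<noteq> 0" using sixteen fifteen by (metis mult_eq_0_iff)
  hence "poly (pderiv [:0, 16, 17, 1:]) r \<noteq> 0" if "r \<in> {0, -1, -16::'a}" for r
    using that sixteen fifteen by (auto simp: pderiv_pCons)
  hence "coprime (pderiv [:0, 16, 17, 1::'a:]) (root_product {0, -1, -16})"
    by (rule coprime_root_product)
  thus "coprime [:0, 16, 17, 1::'a:] (pderiv [:0, 16, 17, 1:])"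
    unfolding factored by (simp add: coprime_commute)
qed (rule two)

text \<open>
  The substitution \<open>u = -4z\<close> turns the cubic with leading coefficient \<open>-4\<close> into a monic one, at the cost
  of the factor \<open>16\<close>, which is a square and so invisible to the character.
\<close>

lemma T_sum_eq_cubic_sum:
  assumes "CARD('p::prime_card) \<ge> 11"
  shows "T_sum TYPE('p) = (\<Sum>u\<in>(UNIV :: 'p mod_ring set). quadratic_character (poly [:0, 16, 17, 1:] u))"
proof -
  note two = two_and_fifteen_nonzero_mod_ring(1)[OF assms]
  have "(4::'p mod_ring) = 2 ^ 2" by simp
  hence four: "(4::'p mod_ring) \<noteq> 0" using two by (metis power_not_zero)
  have "T_sum TYPE('p) =
    (\<Sum>z\<in>(UNIV :: 'p mod_ring set). quadratic_character (4^2 * (z * (z - 4) * (1 - 4 * z))))"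
    unfolding T_sum_def quadratic_character_mult[OF two, of "4^2"]
      quadratic_character_square[OF four] by simp
  also have "\<dots> = (\<Sum>u\<in>(UNIV :: 'p mod_ring set). quadratic_character (poly [:0, 16, 17, 1:] u))"
  proof (rule sum.reindex_bij_witness[of _ "\<lambda>u. - u / 4" "\<lambda>z. - 4 * z"], goal_cases)
    case (5 z)
    have "poly [:0, 16, 17, 1:] (- 4 * z) = 4^2 * (z * (z - 4) * (1 - 4 * z))"
      by (simp add: power2_eq_square algebra_simps)
    thus ?case by (simp only:)
  qed (use four in auto)
  finally show ?thesis .
qed

theorem theorem7:
  fixes p :: nat
  assumes "CARD('p::prime_card) = p" and "prime p" and "p \<ge> 11"
  shows "real (card (A_set TYPE('p))) = (real p + 1 + real_of_int (T_sum TYPE('p))) / 8 \<and>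
         \<bar>real_of_int (T_sum TYPE('p))\<bar> \<le> 2 * sqrt (real p) \<and>
         real (card (A_set TYPE('p))) \<ge> (real p + 1 - 2 * sqrt (real p)) / 8 \<and>
         (real p + 1 - 2 * sqrt (real p)) / 8 > 0"
proof -
  have p: "CARD('p) \<ge> 11" using assms by simp
  note two = two_and_fifteen_nonzero_mod_ring(1)[OF p] and fifteen = two_and_fifteen_nonzero_mod_ring(2)[OF p]
  have count: "8 * int (card (A_set TYPE('p))) = int p + 1 + T_sum TYPE('p)"
    using card_eq_character_sum[OF two fifteen] assms(1) unfolding A_set_def T_sum_def by simp
  have "(T_sum TYPE('p))^2 \<le> 4 * int p"
    using hasse_bound[OF separable_cubic_17_16_0[OF two fifteen], of 1] assms(1)
    unfolding T_sum_eq_cubic_sum[OF p] by simp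
  hence "real_of_int ((T_sum TYPE('p))^2) \<le> real_of_int (4 * int p)"
    by (simp only: of_int_le_iff)
  hence "(real_of_int (T_sum TYPE('p)))^2 \<le> 4 * real p" by simp
  hence "sqrt ((real_of_int (T_sum TYPE('p)))^2) \<le> sqrt (4 * real p)"
    by (rule real_sqrt_le_mono)
  hence bound: "\<bar>real_of_int (T_sum TYPE('p))\<bar> \<le> 2 * sqrt (real p)"
    by (simp add: real_sqrt_mult)
  have "8 * real (card (A_set TYPE('p))) = real p + 1 + real_of_int (T_sum TYPE('p))"
    using arg_cong[OF count, of real_of_int] by simp
  hence card_eq: "real (card (A_set TYPE('p))) = (real p + 1 + real_of_int (T_sum TYPE('p))) / 8"
    by simp
  have "sqrt (real p) \<noteq> 1" using assms(3) by simp
  hence "(sqrt (real p) - 1)^2 > 0" by simp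
  moreover have "(sqrt (real p) - 1)^2 = real p + 1 - 2 * sqrt (real p)"
    by (simp add: power2_eq_square algebra_simps)
  ultimately have "(real p + 1 - 2 * sqrt (real p)) / 8 > 0" by simp
  thus ?thesis using card_eq bound by (auto simp: abs_le_iff)
qed

end
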